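(* Let $n$ be a positive integer, let $D$ be a Hamiltonian digraph with chromatic number $\chi(D)=2n$, and let $C$ be an oriented cycle of order $n$. Then $D$ contains a subdivision of $C$ (as a subdigraph).
   Context: All graphs are finite and simple (no loops, no multiple edges). A digraph (oriented graph) is obtained from a simple graph by assigning exactly one direction to each edge; in particular it has no loops, no parallel arcs, and no pair of opposite arcs $(u,v),(v,u)$. The underlying graph $G(D)$ of a digraph $D$ is the graph obtained by ignoring the arc directions, and the chromatic number $\chi(D)$ is $\chi(G(D))$; a $k$-chromatic digraph is one with chromatic number $k$. A circuit is a directed cycle. A digraph is Hamiltonian if it contains a Hamiltonian circuit, i.e. a directed cycle passing through all its vertices. An oriented cycle is a digraph whose underlying graph is a cycle (its arcs may be oriented arbitrarily); its order is its number of vertices (so the order is at least $3$). A subdivision of a digraph $F$ is a digraph obtained from $F$ by replacing each arc $(x,y)$ with a directed path from $x$ to $y$ of length at least $1$ (the replacing paths being pairwise internally disjoint, with new internal vertices). *)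

theory Defs
  imports "Graph_Theory.Kuratowski"
begin

text \<open>
  Digraphs are of type \<^typ>\<open>'a pair_pre_digraph\<close>: arcs are pairs of vertices, so there are no
  parallel arcs. The locale \<^locale>\<open>pair_digraph\<close> adds finiteness, well-formedness and the
  absence of loops. Undirected graphs are symmetric digraphs.
\<close>

locale oriented_digraph = pair_digraph D for D :: "'a pair_pre_digraph" +
  assumes no_opposite_arcs: "(u, v) \<in> parcs D \<Longrightarrow> (v, u) \<notin> parcs D"

abbreviation underlying_graph :: "'a pair_pre_digraph \<Rightarrow> 'a pair_pre_digraph" where
  "underlying_graph D \<equiv> mk_symmetric (with_proj D)"

definition proper_coloring :: "'a pair_pre_digraph \<Rightarrow> nat \<Rightarrow> ('a \<Rightarrow> nat) \<Rightarrow> bool" where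
  "proper_coloring G k c \<longleftrightarrow>
     c ` pverts G \<subseteq> {..<k} \<and> (\<forall>(u, v) \<in> parcs G. c u \<noteq> c v)"

definition graph_chromatic_number :: "'a pair_pre_digraph \<Rightarrow> nat" where
  "graph_chromatic_number G = (LEAST k. \<exists>c. proper_coloring G k c)"

definition chromatic_number :: "'a pair_pre_digraph \<Rightarrow> nat" where
  "chromatic_number D = graph_chromatic_number (underlying_graph D)"

text \<open>
  The library's \<^const>\<open>pre_digraph.cycle\<close> also admits loops and cycles of length two; an
  oriented digraph contains neither.
\<close>

definition hamiltonian :: "'a pair_pre_digraph \<Rightarrow> bool" where
  "hamiltonian D \<longleftrightarrow>
     (\<exists>p. pre_digraph.cycle (with_proj D) p \<and> fst ` set p = pverts D)"

text \<open>
  In a symmetric digraph an edge traversed back and forth is a \<^const>\<open>pre_digraph.cycle\<close>,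
  hence the explicit bound on the length. The cycle fixes one direction for each of its edges,
  and the symmetric digraph has both.
\<close>

definition cycle_graph :: "'a pair_pre_digraph \<Rightarrow> bool" where
  "cycle_graph G \<longleftrightarrow>
     (\<exists>p. pre_digraph.cycle (with_proj G) p \<and> 3 \<le> length p \<and>
          pverts G = fst ` set p \<and> parcs G = set p \<union> (set p)\<inverse>)"

definition oriented_cycle :: "'a pair_pre_digraph \<Rightarrow> bool" where
  "oriented_cycle C \<longleftrightarrow> oriented_digraph C \<and> cycle_graph (underlying_graph C)"

text \<open>
  \<open>H\<close> is a subdivision of \<open>F\<close>, up to renaming the vertices of \<open>F\<close> by the injection \<open>f\<close>: the arc
  \<open>(x, y)\<close> is replaced by the directed path \<open>P (x, y)\<close> from \<open>f x\<close> to \<open>f y\<close>. The predicate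
  \<^const>\<open>pre_digraph.gen_iapath\<close> says that this is a path with at least one arc, none of whose
  internal vertices is a branch vertex (an image of a vertex of \<open>F\<close>).
\<close>

definition digraph_subdivision :: "'b pair_pre_digraph \<Rightarrow> 'a pair_pre_digraph \<Rightarrow> bool" where
  "digraph_subdivision F H \<longleftrightarrow>
     (\<exists>(f :: 'b \<Rightarrow> 'a) (P :: 'b \<times> 'b \<Rightarrow> ('a \<times> 'a) awalk).
        inj_on f (pverts F) \<and>
        (\<forall>(x, y) \<in> parcs F.
           pre_digraph.gen_iapath (with_proj H) (f ` pverts F) (f x) (P (x, y)) (f y)) \<and>
        (\<forall>e \<in> parcs F. \<forall>e' \<in> parcs F. e \<noteq> e' \<longrightarrow>
           set (pre_digraph.inner_verts (with_proj H) (P e)) \<inter>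
           set (pre_digraph.inner_verts (with_proj H) (P e')) = {}) \<and>
        pverts H = f ` pverts F \<union>
          (\<Union>e \<in> parcs F. set (pre_digraph.inner_verts (with_proj H) (P e))) \<and>
        parcs H = (\<Union>e \<in> parcs F. set (P e)))"

definition contains_subdivision :: "'a pair_pre_digraph \<Rightarrow> 'b pair_pre_digraph \<Rightarrow> bool" where
  "contains_subdivision D F \<longleftrightarrow>
     (\<exists>H :: 'a pair_pre_digraph.
        subgraph (with_proj H) (with_proj D) \<and> digraph_subdivision F H)"

end

theory Submission
  imports Defs
begin

text \<open>
  Traverse the oriented cycle \<open>C\<close> in the direction in which at most half of its arcs are
  backward, starting with a forward arc. The directions then form a word
  \<open>F B\<^bsup>q1\<^esup> F B\<^bsup>q2\<^esup> \<dots>\<close>, where a run \<open>B\<^bsup>q\<^esup>\<close> may be empty. Following a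
  Hamiltonian circuit of \<open>D\<close> realizes forward arcs, so only the backward
  runs need chords. For a run of length \<open>q\<close> reserve an interval of the circuit whose chromatic
  number is at least \<open>3q + 1\<close>. The total demand is \<open>\<Sum>(3q + 1)\<close>, which is three times the number
  of backward arcs plus the number of forward arcs, hence at most \<open>2n\<close>; as chromatic number is
  subadditive over intervals, the circuit can be cut accordingly.

  For \<open>q > 0\<close>, an interval of chromatic number greater than \<open>3q\<close> contains a subgraph of minimum degree at
  least \<open>3q\<close>, and that forces two crossing edges, \<open>a\<close> to \<open>b\<close> and \<open>c\<close> to \<open>d\<close> with
  \<open>a < c < b < d\<close>, such that \<open>b\<close> is at least \<open>q\<close> positions after \<open>c\<close>
  (\<open>not_colourable_imp_crossing_edges\<close>). Traverse the interval from its first vertex to \<open>a\<close>, jump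
  to \<open>b\<close>, go back along the circuit to \<open>c\<close>, jump to \<open>d\<close> and go on to the end. Whatever the
  directions of the two chords, each of them extends either the backward stretch in the middle or
  the forward stretch next to it, so the word of this traversal is
  \<open>F\<^bsup>i\<^esup> B\<^bsup>j\<^esup> F\<^bsup>k\<^esup>\<close> with \<open>j \<ge> q\<close> (\<open>detour\<close>). Concatenating the traversals of all
  intervals gives an oriented cycle of \<open>D\<close> whose word arises from that of \<open>C\<close> by repeating
  letters (\<open>closed_traversal\<close>), and such a cycle is a subdivision of \<open>C\<close>
  (\<open>contains_subdivision_if_stretch\<close>).
\<close>

section \<open>Crossing edges in graphs of large chromatic number\<close>

text \<open>
  Colourings of the vertices in \<open>S\<close> only, for the graph whose edges are the arcs in \<open>A\<close> without
  their directions; the part of \<open>A\<close> outside \<open>S\<close> and its loops are ignored, so that the notion can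
  be restricted to intervals without changing \<open>A\<close>.
\<close>

definition colourable :: "'v rel \<Rightarrow> 'v set \<Rightarrow> nat \<Rightarrow> bool" where
  "colourable A S k \<longleftrightarrow>
     (\<exists>c. (\<forall>v\<in>S. c v < k) \<and> (\<forall>u\<in>S. \<forall>v\<in>S. u \<noteq> v \<and> (u, v) \<in> A \<longrightarrow> c u \<noteq> (c v :: nat)))"

definition adjacent :: "'v rel \<Rightarrow> 'v \<Rightarrow> 'v \<Rightarrow> bool" where
  "adjacent A u v \<longleftrightarrow> (u, v) \<in> A \<or> (v, u) \<in> A"

lemma adjacent_sym: "adjacent A u v \<Longrightarrow> adjacent A v u"
  by (auto simp: adjacent_def)

lemma colourable_empty [simp]: "colourable A {} k"
  by (simp add: colourable_def)

lemma colourable_singleton: "colourable A {v} (Suc k)"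
  by (auto simp: colourable_def)

lemma colourable_Un:
  assumes "colourable A S k" and "colourable A T l"
  shows "colourable A (S \<union> T) (k + l)"
proof -
  obtain c where c: "\<forall>v\<in>S. c v < k" "\<forall>u\<in>S. \<forall>v\<in>S. u \<noteq> v \<and> (u, v) \<in> A \<longrightarrow> c u \<noteq> c v"
    using assms(1) unfolding colourable_def by blast
  obtain d where d: "\<forall>v\<in>T. d v < l" "\<forall>u\<in>T. \<forall>v\<in>T. u \<noteq> v \<and> (u, v) \<in> A \<longrightarrow> d u \<noteq> d v"
    using assms(2) unfolding colourable_def by blast
  let ?e = "\<lambda>v. if v \<in> S then c v else k + d v"
  have "\<forall>v\<in>S \<union> T. ?e v < k + l" using c(1) d(1) by auto
  moreover have "\<forall>u\<in>S \<union> T. \<forall>v\<in>S \<union> T. u \<noteq> v \<and> (u, v) \<in> A \<longrightarrow> ?e u \<noteq> ?e v"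
  proof (intro ballI impI)
    fix u v
    assume "u \<in> S \<union> T" "v \<in> S \<union> T" "u \<noteq> v \<and> (u, v) \<in> A"
    then show "?e u \<noteq> ?e v"
      using c d by (cases "u \<in> S"; cases "v \<in> S") (auto dest: bspec)
  qed
  ultimately show ?thesis unfolding colourable_def by (intro exI[of _ ?e]) blast
qed

text \<open>
  A vertex with fewer than \<open>k\<close> neighbours can always be coloured last, so it may be deleted from a
  set that is not \<open>k\<close>-colourable. When no deletion is possible any more, all degrees are large.
\<close>

lemma not_colourable_imp_min_degree:
  assumes "finite S" and "\<not> colourable A S k"
  shows "\<exists>T\<subseteq>S. T \<noteq> {} \<and> (\<forall>v\<in>T. k \<le> card {u \<in> T. u \<noteq> v \<and> adjacent A u v})"
  using assms
proof (induction S rule: finite_psubset_induct)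
  case (psubset S)
  show ?case
  proof (cases "\<exists>v\<in>S. card {u \<in> S. u \<noteq> v \<and> adjacent A u v} < k")
    case True
    then obtain v where v: "v \<in> S" and small: "card {u \<in> S. u \<noteq> v \<and> adjacent A u v} < k"
      by blast
    have "\<not> colourable A (S - {v}) k"
    proof
      assume "colourable A (S - {v}) k"
      then obtain c where c: "\<forall>u\<in>S - {v}. c u < k"
        "\<forall>u\<in>S - {v}. \<forall>w\<in>S - {v}. u \<noteq> w \<and> (u, w) \<in> A \<longrightarrow> c u \<noteq> c w"
        unfolding colourable_def by blast
      let ?N = "{u \<in> S. u \<noteq> v \<and> adjacent A u v}"
      have "card (c ` ?N) \<le> card ?N" using psubset.hyps by (intro card_image_le) auto
      with small have "card (c ` ?N) < card {..<k}" by simp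
      then have "\<not> {..<k} \<subseteq> c ` ?N"
        using card_mono[of "c ` ?N" "{..<k}"] psubset.hyps by fastforce
      then obtain x where x: "x < k" "x \<notin> c ` ?N" by auto
      have "colourable A S k"
        unfolding colourable_def
      proof (intro exI[of _ "c(v := x)"] conjI ballI impI)
        fix u assume "u \<in> S"
        then show "(c(v := x)) u < k" using c(1) x(1) by auto
      next
        fix u w assume "u \<in> S" "w \<in> S" "u \<noteq> w \<and> (u, w) \<in> A"
        then show "(c(v := x)) u \<noteq> (c(v := x)) w"
          using c(2) x(2) by (auto simp: adjacent_def)
      qed
      with psubset.prems show False by blast
    qed
    moreover have "S - {v} \<subset> S" using v by blast
    ultimately have "\<exists>T\<subseteq>S - {v}. T \<noteq> {} \<and>
        (\<forall>v\<in>T. k \<le> card {u \<in> T. u \<noteq> v \<and> adjacent A u v})"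
      by (intro psubset.IH)
    then show ?thesis by (meson Diff_subset order_trans)
  next
    case False
    moreover have "S \<noteq> {}" using psubset.prems by auto
    ultimately show ?thesis by (intro exI[of _ S]) (simp add: not_less)
  qed
qed

text \<open>
  Choose a shortest edge \<open>u v\<close> among those that span at least \<open>2q\<close> positions and look at the vertex
  \<open>w = u + q\<close>. If all its neighbours lay between \<open>u\<close> and \<open>v\<close>, there would be at most \<open>q\<close> of them
  on the left and, by minimality, at most \<open>2q - 1\<close> on the right, too few for the degree of \<open>w\<close>.
  So an edge from \<open>w\<close> leaves the span of \<open>u v\<close> on one side, and \<open>w\<close> is at distance at least \<open>q\<close>
  from either end.
\<close>

lemma crossing_pair_if_min_degree:
  fixes R :: "nat \<Rightarrow> nat \<Rightarrow> bool"
  assumes sym: "\<And>i j. R i j \<Longrightarrow> R j i"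
    and "0 < m" and "0 < q"
    and deg: "\<And>i. i < m \<Longrightarrow> 3 * q \<le> card {j. j < m \<and> j \<noteq> i \<and> R i j}"
  obtains i k j l where "i < k" "k < j" "j < l" "l < m" "R i j" "R k l" "k + q \<le> j"
proof -
  let ?P = "\<lambda>(u, v). u + 2 * q \<le> v \<and> v < m \<and> R u v"
  \<comment> \<open>The first vertex has all its neighbours on the right, hence a distant one.\<close>
  have "\<exists>j. ?P (0, j)"
  proof (rule ccontr)
    assume "\<not> (\<exists>j. ?P (0, j))"
    then have "{j. j < m \<and> j \<noteq> 0 \<and> R 0 j} \<subseteq> {0<..<2 * q}" by fastforce
    then have "card {j. j < m \<and> j \<noteq> 0 \<and> R 0 j} \<le> card {0<..<2 * q}"
      by (intro card_mono) auto
    with deg[OF \<open>0 < m\<close>] \<open>0 < q\<close> show False by simp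
  qed
  then obtain e where e: "?P e" "\<And>e'. ?P e' \<Longrightarrow> snd e - fst e \<le> snd e' - fst e'"
    using ex_has_least_nat[of ?P _ "\<lambda>e. snd e - fst e"] by blast
  obtain u v where uv: "e = (u, v)" by (cases e)
  have long: "u + 2 * q \<le> v" "v < m" "R u v" using e(1) uv by auto
  have least: "v - u \<le> v' - u'" if "u' + 2 * q \<le> v'" "v' < m" "R u' v'" for u' v'
    using e(2)[of "(u', v')"] that uv by auto
  define w where "w = u + q"
  have "\<exists>j. j < m \<and> R w j \<and> (j < u \<or> v < j)"
  proof (rule ccontr)
    assume none: "\<not> ?thesis"
    have "{j. j < m \<and> j \<noteq> w \<and> R w j} \<subseteq> {u..<w} \<union> {w<..<w + 2 * q}"
    proof
      fix j assume j: "j \<in> {j. j < m \<and> j \<noteq> w \<and> R w j}"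
      with none have "u \<le> j" "j \<le> v" by auto
      moreover have "j < w + 2 * q" 
      proof (rule ccontr)
        assume "\<not> ?thesis"
        with j have "v - u \<le> j - w" by (intro least) auto
        with \<open>j \<le> v\<close> \<open>0 < q\<close> \<open>u + 2 * q \<le> v\<close> \<open>\<not> ?thesis\<close> show False by (simp add: w_def)
      qed
      ultimately show "j \<in> {u..<w} \<union> {w<..<w + 2 * q}" using j by auto
    qed
    then have "card {j. j < m \<and> j \<noteq> w \<and> R w j} \<le> card ({u..<w} \<union> {w<..<w + 2 * q})"
      by (intro card_mono) auto
    also have "\<dots> \<le> q + (2 * q - 1)"
      using card_Un_le[of "{u..<w}" "{w<..<w + 2 * q}"] by (simp add: w_def)
    finally show False using deg[of w] long \<open>0 < q\<close> by (simp add: w_def)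
  qed
  then obtain j where j: "j < m" "R w j" "j < u \<or> v < j" by blast
  from j(3) show thesis
  proof
    assume "j < u"
    then show thesis using that[of j u w v] j sym long \<open>0 < q\<close> by (simp add: w_def)
  next
    assume "v < j"
    then show thesis using that[of u w v j] j sym long \<open>0 < q\<close> by (simp add: w_def)
  qed
qed

lemma filter_eq_append_ConsE:
  assumes "filter P ys = X @ x # Y"
  obtains X' Y' where "ys = X' @ x # Y'" "filter P X' = X" "filter P Y' = Y"
  using assms
proof (induction ys arbitrary: X thesis)
  case (Cons y ys)
  show ?case
  proof (cases "P y \<and> X = []")
    case True
    then show ?thesis using Cons.prems(1)[of "[]" ys] Cons.prems(2) by simp
  next
    case False
    have "filter P ys = (if P y then tl X else X) @ x # Y"
      using Cons.prems(2) False by (cases X) auto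
    then obtain X' Y' where X': "ys = X' @ x # Y'" "filter P X' = (if P y then tl X else X)"
      "filter P Y' = Y"
      using Cons.IH by blast
    have "P y \<Longrightarrow> X = y # tl X" using Cons.prems(2) False by (cases X) auto
    then show ?thesis using Cons.prems(1)[of "y # X'" Y'] X' by auto
  qed
qed simp

lemma split_at_four:
  assumes "i < k" "k < j" "j < l" "l < length zs"
  obtains P Q M E G where
    "zs = P @ zs ! i # Q @ zs ! k # M @ zs ! j # E @ zs ! l # G" "length M = j - Suc k"
proof -
  have split: "drop a zs = take (b - a) (drop a zs) @ zs ! b # drop (Suc b) zs"
    if "a \<le> b" "b < length zs" for a b
    using id_take_nth_drop[of "b - a" "drop a zs"] that by (simp add: nth_drop drop_drop)
  have "zs = take i zs @ zs ! i # drop (Suc i) zs"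
    using id_take_nth_drop[of i zs] assms by simp
  also have "drop (Suc i) zs = take (k - Suc i) (drop (Suc i) zs) @ zs ! k # drop (Suc k) zs"
    using assms by (intro split) auto
  also have "drop (Suc k) zs = take (j - Suc k) (drop (Suc k) zs) @ zs ! j # drop (Suc j) zs"
    using assms by (intro split) auto
  also have "drop (Suc j) zs = take (l - Suc j) (drop (Suc j) zs) @ zs ! l # drop (Suc l) zs"
    using assms by (intro split) auto
  finally show thesis using assms by (intro that) auto
qed

text \<open>
  The degree argument takes place on the vertices of a dense subgraph, listed in the order of \<open>ys\<close>.
  Passing back to \<open>ys\<close> only adds vertices between \<open>c\<close> and \<open>b\<close>.
\<close>

lemma not_colourable_imp_crossing_edges:
  assumes "distinct ys" and "0 < q" and "\<not> colourable A (set ys) (3 * q)"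
  obtains P a Q c M b E d G where "ys = P @ a # Q @ c # M @ b # E @ d # G"
    "adjacent A a b" "adjacent A c d" "q \<le> Suc (length M)"
proof -
  obtain T where T: "T \<subseteq> set ys" "T \<noteq> {}"
    "\<And>v. v \<in> T \<Longrightarrow> 3 * q \<le> card {u \<in> T. u \<noteq> v \<and> adjacent A u v}"
    using not_colourable_imp_min_degree[OF _ assms(3)] by auto
  define zs where "zs = filter (\<lambda>v. v \<in> T) ys"
  have zs: "set zs = T" "distinct zs" using T(1) assms(1) by (auto simp: zs_def)
  let ?R = "\<lambda>i j. adjacent A (zs ! i) (zs ! j)"
  have deg: "3 * q \<le> card {j. j < length zs \<and> j \<noteq> i \<and> ?R i j}" if "i < length zs" for i
  proof -
    let ?J = "{j. j < length zs \<and> j \<noteq> i \<and> ?R i j}"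
    have "{u \<in> T. u \<noteq> zs ! i \<and> adjacent A u (zs ! i)} \<subseteq> (!) zs ` ?J"
    proof
      fix u assume u: "u \<in> {u \<in> T. u \<noteq> zs ! i \<and> adjacent A u (zs ! i)}"
      then obtain j where "j < length zs" "u = zs ! j" using zs(1) by (auto simp: in_set_conv_nth)
      with u show "u \<in> (!) zs ` ?J" by (auto intro: adjacent_sym)
    qed
    then have "card {u \<in> T. u \<noteq> zs ! i \<and> adjacent A u (zs ! i)} \<le> card ((!) zs ` ?J)"
      by (intro card_mono) auto
    also have "\<dots> \<le> card ?J" by (intro card_image_le) auto
    finally show ?thesis using T(3)[of "zs ! i"] that zs(1) by auto
  qed
  have nonempty: "0 < length zs" using zs T(2) by auto
  obtain i k j l where ikjl: "i < k" "k < j" "j < l" "l < length zs" "?R i j" "?R k l"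
    "k + q \<le> j"
    by (rule crossing_pair_if_min_degree[of ?R "length zs" q, OF adjacent_sym nonempty assms(2) deg])
  obtain P Q M E G where
    1: "filter (\<lambda>v. v \<in> T) ys = P @ zs ! i # Q @ zs ! k # M @ zs ! j # E @ zs ! l # G"
    and M: "length M = j - Suc k"
    by (rule split_at_four[OF ikjl(1-4)]) (simp add: zs_def)
  obtain P' Y1 where 2: "ys = P' @ zs ! i # Y1"
    "filter (\<lambda>v. v \<in> T) Y1 = Q @ zs ! k # M @ zs ! j # E @ zs ! l # G"
    by (rule filter_eq_append_ConsE[OF 1])
  obtain Q' Y2 where 3: "Y1 = Q' @ zs ! k # Y2"
    "filter (\<lambda>v. v \<in> T) Y2 = M @ zs ! j # E @ zs ! l # G"
    by (rule filter_eq_append_ConsE[OF 2(2)])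
  obtain M' Y3 where 4: "Y2 = M' @ zs ! j # Y3" "filter (\<lambda>v. v \<in> T) M' = M"
    "filter (\<lambda>v. v \<in> T) Y3 = E @ zs ! l # G"
    by (rule filter_eq_append_ConsE[OF 3(2)])
  obtain E' G' where 5: "Y3 = E' @ zs ! l # G'"
    by (rule filter_eq_append_ConsE[OF 4(3)])
  have "length M \<le> length M'" using 4(2) by auto
  with M ikjl(2,7) have "q \<le> Suc (length M')" by linarith
  with ikjl(5,6) show thesis
    using that[of P' "zs ! i" Q' "zs ! k" M' "zs ! j" E' "zs ! l" G'] 2(1) 3(1) 4(1) 5 by simp
qed

section \<open>Walks with directions\<close>

text \<open>
  An oriented walk is a list of vertices, each with the direction in which the arc to the next
  vertex is passed (\<^term>\<open>True\<close> for forward). The end vertex is not part of the list but a separate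
  parameter \<open>y\<close>. Hence walks compose by appending lists, a path is described
  by all its vertices but the last, and a cycle is a walk that ends in its own first vertex.
\<close>

definition start :: "('v \<times> bool) list \<Rightarrow> 'v \<Rightarrow> 'v" where
  "start ps y = (case ps of [] \<Rightarrow> y | p # _ \<Rightarrow> fst p)"

primrec walk_arcs :: "('v \<times> bool) list \<Rightarrow> 'v \<Rightarrow> ('v \<times> 'v) list" where
  "walk_arcs [] y = []"
| "walk_arcs (p # ps) y =
     (if snd p then (fst p, start ps y) else (start ps y, fst p)) # walk_arcs ps y"

abbreviation forward :: "'v list \<Rightarrow> ('v \<times> bool) list" where
  "forward xs \<equiv> map (\<lambda>v. (v, True)) xs"

abbreviation closed_walk_arcs :: "('v \<times> bool) list \<Rightarrow> ('v \<times> 'v) list" where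
  "closed_walk_arcs ps \<equiv> walk_arcs ps (fst (hd ps))"

lemma start_Nil [simp]: "start [] y = y"
  and start_Cons [simp]: "start (p # ps) y = fst p"
  by (simp_all add: start_def)

lemma start_append [simp]: "start (ps @ qs) y = start ps (start qs y)"
  by (cases ps) simp_all

lemma start_nonempty: "ps \<noteq> [] \<Longrightarrow> start ps y = fst (hd ps)"
  by (cases ps) simp_all

lemma walk_arcs_append [simp]:
  "walk_arcs (ps @ qs) y = walk_arcs ps (start qs y) @ walk_arcs qs y"
  by (induction ps) simp_all

lemma set_closed_walk_arcs_rotate:
  "set (closed_walk_arcs (qs @ ps)) = set (closed_walk_arcs (ps @ qs))"
  by (cases ps; cases qs) auto

text \<open>
  The reversal of a walk to \<open>y\<close> starts in \<open>y\<close> and leaves out its new end, the old start.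
\<close>

primrec reverse_walk :: "('v \<times> bool) list \<Rightarrow> 'v \<Rightarrow> ('v \<times> bool) list" where
  "reverse_walk [] y = []"
| "reverse_walk (p # ps) y = reverse_walk ps y @ [(start ps y, \<not> snd p)]"

lemma start_reverse_walk: "start (reverse_walk ps y) x = (if ps = [] then x else y)"
  by (induction ps arbitrary: x) auto

lemma walk_arcs_reverse_walk:
  "walk_arcs (reverse_walk ps y) (start ps y) = rev (walk_arcs ps y)"
  by (induction ps) simp_all

lemma map_fst_reverse_walk: "map fst (reverse_walk ps y) = rev (tl (map fst ps @ [y]))"
proof (induction ps)
  case (Cons p ps)
  then show ?case by (cases ps) simp_all
qed simp

lemma map_snd_reverse_walk: "map snd (reverse_walk ps y) = rev (map (\<lambda>p. \<not> snd p) ps)"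
  by (induction ps) simp_all

section \<open>Traversing an interval with a long backward stretch\<close>

text \<open>
  The traversal through the crossing edges. Here \<open>z\<close> is the vertex that follows the interval on the
  circuit; the arc to it makes the final forward stretch nonempty. For \<open>q = 0\<close> the interval is merely
  nonempty, and it is traversed without any backward arc.
\<close>

lemma detour:
  assumes "distinct ys" and "set (walk_arcs (forward ys) z) \<subseteq> A"
    and "\<not> colourable A (set ys) (3 * q)"
  obtains ps a b c where "distinct (map fst ps)" "fst ` set ps \<subseteq> set ys"
    "start ps z = start (forward ys) z" "set (walk_arcs ps z) \<subseteq> A"
    "map snd ps = replicate a True @ replicate b False @ replicate (Suc c) True"
    "q \<le> b" "q = 0 \<Longrightarrow> b = 0"
proof (cases "q = 0")
  case True
  then have "ys \<noteq> []" using assms(3) by auto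
  then have "map snd (forward ys) =
      replicate 0 True @ replicate 0 False @ replicate (Suc (length ys - 1)) True"
    by (simp add: comp_def map_replicate_const flip: replicate_Suc)
  with assms(1,2) True show thesis by (intro that[of "forward ys" 0 0]) (auto simp: comp_def)
next
  case False
  then obtain P a Q c M b E d G where ys: "ys = P @ a # Q @ c # M @ b # E @ d # G"
    and ab: "adjacent A a b" and cd: "adjacent A c d" and M: "q \<le> Suc (length M)"
    using not_colourable_imp_crossing_edges[OF assms(1) _ assms(3)] by blast
  \<comment> \<open>The directions in which the two chords are passed. The forward stretch from \<open>P\<close> is lengthened
    by the first chord or the backward stretch is, and similarly for the second chord.\<close>
  define \<alpha> and \<gamma> where "\<alpha> = ((a, b) \<in> A)" and "\<gamma> = ((c, d) \<in> A)"
  define seg where "seg = reverse_walk (forward (c # M)) b"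
  define ps where "ps = forward P @ (a, \<alpha>) # seg @ (c, \<gamma>) # forward (d # G)"
  have fst_seg: "map fst seg = b # rev M"
    by (simp add: seg_def map_fst_reverse_walk comp_def del: reverse_walk.simps)
  have snd_seg: "map snd seg = replicate (Suc (length M)) False"
    by (simp add: seg_def map_snd_reverse_walk comp_def map_replicate_const
        del: reverse_walk.simps flip: replicate_Suc replicate_append_same)
  have start_seg: "start seg x = b" for x
    unfolding seg_def start_reverse_walk by simp
  have "walk_arcs seg c = rev (walk_arcs (forward (c # M)) b)"
    unfolding seg_def using walk_arcs_reverse_walk[of "forward (c # M)" b] by simp
  then have arcs_seg: "set (walk_arcs seg c) \<subseteq> A"
    using assms(2) unfolding ys by auto
  have 1: "distinct (map fst ps)" "fst ` set ps \<subseteq> set ys"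
  proof -
    have fsts: "map fst ps = P @ a # b # rev M @ c # d # G"
      using fst_seg by (simp add: ps_def comp_def)
    show "distinct (map fst ps)" using assms(1) unfolding fsts ys by auto
    have "set (map fst ps) \<subseteq> set ys" unfolding fsts ys by auto
    then show "fst ` set ps \<subseteq> set ys" by simp
  qed
  have 2: "start ps z = start (forward ys) z" by (simp add: ps_def ys)
  have 3: "set (walk_arcs ps z) \<subseteq> A"
    using assms(2) arcs_seg ab cd unfolding ys
    by (auto simp: ps_def start_seg \<alpha>_def \<gamma>_def adjacent_def)
  have "map snd ps = replicate (length P) True @ \<alpha> # replicate (Suc (length M)) False @
      \<gamma> # replicate (Suc (length G)) True"
    using snd_seg by (simp add: ps_def comp_def map_replicate_const)
  also have "\<dots> = replicate (length P + of_bool \<alpha>) True @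
      replicate (of_bool (\<not> \<alpha>) + Suc (length M) + of_bool (\<not> \<gamma>)) False @
      replicate (Suc (of_bool \<gamma> + length G)) True"
    by (cases \<alpha>; cases \<gamma>) (simp_all add: replicate_add replicate_app_Cons_same)
  finally show thesis by (rule that[OF 1 2 3]) (use M False in auto)
qed

section \<open>Words of directions\<close>

text \<open>
  \<open>stretch w W\<close>: the word \<open>W\<close> arises from \<open>w\<close> by replacing each letter by one or more copies.
  For orientations this is what subdividing does.
\<close>

inductive stretch :: "'c list \<Rightarrow> 'c list \<Rightarrow> bool" where
  stretch_Nil: "stretch [] []"
| stretch_Cons: "stretch w W \<Longrightarrow> stretch (d # w) (replicate (Suc m) d @ W)"

lemma stretch_extend:
  assumes "stretch (d # w) W"
  shows "stretch (d # w) (replicate k d @ W)"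
  using assms
proof cases
  case (stretch_Cons V m)
  have "replicate k d @ W = replicate (Suc (k + m)) d @ V"
    unfolding stretch_Cons(1) by (simp add: replicate_add replicate_app_Cons_same)
  then show ?thesis using stretch.stretch_Cons[OF stretch_Cons(2)] by metis
qed

lemma stretch_replicate:
  assumes "stretch w W" and "q \<le> b" and "q = 0 \<Longrightarrow> b = 0"
  shows "stretch (replicate q d @ w) (replicate b d @ W)"
  using assms(2,3)
proof (induction q arbitrary: b)
  case 0
  then show ?case using assms(1) by simp
next
  case (Suc q)
  then obtain b' where b: "b = Suc b'" by (cases b) auto
  show ?case
  proof (cases "q = 0")
    case True
    then show ?thesis using stretch_Cons[OF assms(1), of d b'] b by simp
  next
    case False
    then have "stretch (replicate q d @ w) (replicate b' d @ W)"
      using Suc b by auto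
    from stretch_Cons[OF this, of d 0] show ?thesis using b by simp
  qed
qed

lemma stretch_snocD:
  assumes "stretch (w @ [d]) V"
  obtains X m where "V = X @ replicate (Suc m) d" "stretch w X"
  using assms
proof (induction w arbitrary: V thesis)
  case Nil
  from Nil(2) obtain W m where "V = replicate (Suc m) d @ W" "stretch [] W"
    by (auto elim: stretch.cases)
  moreover from this(2) have "W = []" by cases
  ultimately show ?case using Nil(1)[of "[]" m] stretch_Nil by simp
next
  case (Cons e w)
  from Cons(3) obtain W m where V: "V = replicate (Suc m) e @ W" and W: "stretch (w @ [d]) W"
    by (auto elim: stretch.cases)
  obtain X k where "W = X @ replicate (Suc k) d" "stretch w X"
    using Cons.IH[OF _ W] by blast
  then show ?case
    using Cons.prems(1)[of "replicate (Suc m) e @ X" k] V stretch_Cons[of w X e m] by simp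
qed

text \<open>
  The list \<open>T\<close> of lengths of the backward runs that follow the forward arcs encodes a word; the cost
  is the chromatic number that suffices to realize it along a circuit.
\<close>

definition word :: "nat list \<Rightarrow> bool list" where
  "word T = concat (map (\<lambda>q. True # replicate q False) T)"

definition cost :: "nat list \<Rightarrow> nat" where
  "cost T = sum_list (map (\<lambda>q. Suc (3 * q)) T)"

lemma word_Nil [simp]: "word [] = []"
  and word_Cons [simp]: "word (q # T) = True # replicate q False @ word T"
  by (simp_all add: word_def)

lemma cost_Nil [simp]: "cost [] = 0"
  and cost_Cons [simp]: "cost (q # T) = Suc (3 * q) + cost T"
  by (simp_all add: cost_def)

lemma word_surj: "\<exists>T. word T = True # u"
proof -
  have "\<exists>q T. u = replicate q False @ word T"
  proof (induction u)
    case Nil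
    show ?case by (intro exI[of _ 0] exI[of _ "[]"]) simp
  next
    case (Cons d u)
    then obtain q T where u: "u = replicate q False @ word T" by blast
    show ?case
    proof (cases d)
      case True
      then show ?thesis using u by (intro exI[of _ 0] exI[of _ "q # T"]) simp
    next
      case False
      then show ?thesis using u by (intro exI[of _ "Suc q"] exI[of _ T]) simp
    qed
  qed
  then show ?thesis by (metis word_Cons)
qed

lemma cost_eq: "cost T = count_list (word T) True + 3 * count_list (word T) False"
proof -
  have "count_list (replicate q False) b = (if b then 0 else q)" for q b
    by (induction q) auto
  then show ?thesis by (induction T) auto
qed

text \<open>
  Cut off the shortest prefix that is not \<open>m\<close>-colourable. One colour more suffices for it, so the
  rest must account for the remaining colours.
\<close>

lemma not_colourable_split:
  assumes "\<And>k. k < Suc m + l \<Longrightarrow> \<not> colourable A (set xs) k"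
  obtains ys zs where "xs = ys @ zs" "\<not> colourable A (set ys) m"
    "\<forall>k<l. \<not> colourable A (set zs) k"
proof -
  let ?P = "\<lambda>n. \<not> colourable A (set (take n xs)) m"
  define n where "n = (LEAST n. ?P n)"
  have "?P (length xs)" using assms[of m] by simp
  then have n: "?P n" unfolding n_def by (rule LeastI)
  then obtain n' where n': "n = Suc n'" by (cases n) auto
  have prefix: "colourable A (set (take n' xs)) m"
    using not_less_Least[of n' ?P] n' unfolding n_def by auto
  have "n' < length xs" using n prefix n' by (metis leI le_SucI take_all)
  then have set_take: "set (take n xs) = set (take n' xs) \<union> {xs ! n'}"
    by (simp add: n' take_Suc_conv_app_nth)
  have "\<not> colourable A (set (drop n xs)) k" if "k < l" for k
  proof
    assume "colourable A (set (drop n xs)) k"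
    then have "colourable A (set (take n xs) \<union> set (drop n xs)) (Suc m + k)"
      using colourable_Un[OF prefix colourable_singleton[of A "xs ! n'" 0]]
      by (intro colourable_Un) (simp_all add: set_take)
    then have "colourable A (set xs) (Suc m + k)"
      by (metis append_take_drop_id set_append)
    with assms[of "Suc m + k"] that show False by simp
  qed
  with n show thesis by (intro that[of "take n xs" "drop n xs"]) auto
qed

text \<open>
  The traversals of consecutive intervals are chained. Each begins with forward arcs that belong to
  the last letter of the previous one. The extra letter \<^term>\<open>True\<close> in front of the walk stands for
  an arc into the first vertex, and the one behind \<^term>\<open>word T\<close> absorbs the forward arcs after the
  last backward run.
\<close>

lemma traversal:
  assumes "distinct xs" and "set (walk_arcs (forward xs) z) \<subseteq> A"
    and "\<And>k. k < cost T \<Longrightarrow> \<not> colourable A (set xs) k"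
  shows "\<exists>ps. distinct (map fst ps) \<and> fst ` set ps \<subseteq> set xs \<and>
    start ps z = start (forward xs) z \<and> set (walk_arcs ps z) \<subseteq> A \<and>
    stretch (word T @ [True]) (True # map snd ps)"
  using assms
proof (induction T arbitrary: xs)
  case Nil
  have "stretch [True] (True # map snd (forward xs))"
    using stretch_Cons[OF stretch_Nil, of True "length xs"] by (simp add: comp_def map_replicate_const)
  with Nil show ?case by (intro exI[of _ "forward xs"]) (auto simp: comp_def)
next
  case (Cons q T)
  have "k < Suc (3 * q) + cost T \<Longrightarrow> \<not> colourable A (set xs) k" for k
    using Cons.prems(3)[of k] by simp
  then obtain ys zs where xs: "xs = ys @ zs" and ys: "\<not> colourable A (set ys) (3 * q)"
    and zs: "\<forall>k<cost T. \<not> colourable A (set zs) k"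
    by (rule not_colourable_split) blast
  let ?z = "start (forward zs) z"
  obtain rs where rs: "distinct (map fst rs)" "fst ` set rs \<subseteq> set zs" "start rs z = ?z"
    "set (walk_arcs rs z) \<subseteq> A" "stretch (word T @ [True]) (True # map snd rs)"
    using Cons.IH[of zs] zs Cons.prems(1,2) unfolding xs by auto
  have "set (walk_arcs (forward ys) ?z) \<subseteq> A" "distinct ys"
    using Cons.prems(1,2) unfolding xs by auto
  then obtain ps a b c where ps: "distinct (map fst ps)" "fst ` set ps \<subseteq> set ys"
    "start ps ?z = start (forward ys) ?z" "set (walk_arcs ps ?z) \<subseteq> A"
    "map snd ps = replicate a True @ replicate b False @ replicate (Suc c) True"
    "q \<le> b" "q = 0 \<Longrightarrow> b = 0"
    using detour[OF _ _ ys] by metis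
  obtain w where w: "word T @ [True] = True # w" by (cases T) auto
  have "stretch (word T @ [True]) (replicate c True @ True # map snd rs)"
    using rs(5) unfolding w by (rule stretch_extend)
  then have "stretch (replicate q False @ word T @ [True])
      (replicate b False @ replicate c True @ True # map snd rs)"
    using ps(6,7) by (rule stretch_replicate)
  from stretch_Cons[OF this, of True a]
  have "stretch (word (q # T) @ [True]) (True # map snd (ps @ rs))"
    using ps(5) by (simp add: replicate_app_Cons_same)
  moreover have "distinct (map fst (ps @ rs))"
    using ps(1,2) rs(1,2) Cons.prems(1) unfolding xs by auto
  moreover have "fst ` set (ps @ rs) \<subseteq> set xs" using ps(2) rs(2) unfolding xs by auto
  moreover have "start (ps @ rs) z = start (forward xs) z" using rs(3) ps(3) unfolding xs by simp
  moreover have "set (walk_arcs (ps @ rs) z) \<subseteq> A" using rs(3,4) ps(4) by simp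
  ultimately show ?case by blast
qed

text \<open>
  On a cycle the final forward arcs are moved to the front, where they merge with the initial ones
  and take the place of the extra letter of the previous lemma.
\<close>

lemma closed_traversal:
  assumes "distinct xs" and "set (closed_walk_arcs (forward xs)) \<subseteq> A" and "T \<noteq> []"
    and "\<And>k. k < cost T \<Longrightarrow> \<not> colourable A (set xs) k"
  obtains ps where "distinct (map fst ps)" "fst ` set ps \<subseteq> set xs"
    "set (closed_walk_arcs ps) \<subseteq> A" "stretch (word T) (map snd ps)"
proof -
  let ?z = "fst (hd (forward xs))"
  obtain ps where ps: "distinct (map fst ps)" "fst ` set ps \<subseteq> set xs"
    "start ps ?z = start (forward xs) ?z" "set (walk_arcs ps ?z) \<subseteq> A"
    "stretch (word T @ [True]) (True # map snd ps)"
    using traversal[where T = T, OF assms(1,2,4)] by auto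
  have "start (forward xs) ?z = ?z" by (cases xs) auto
  with ps(3) have "start ps ?z = ?z" by simp
  then have closed: "closed_walk_arcs ps = walk_arcs ps ?z" by (cases ps) auto
  obtain w where w: "word T = True # w" using assms(3) by (cases T) auto
  obtain X m where X: "True # map snd ps = X @ replicate (Suc m) True" "stretch (word T) X"
    using stretch_snocD[OF ps(5)] .
  from X(2) obtain X' where X': "X = True # X'" unfolding w by (auto elim: stretch.cases)
  with X(1) have "map snd ps = X' @ replicate (Suc m) True" by simp
  then obtain qs rs where qr: "ps = qs @ rs" "map snd qs = X'" "map snd rs = replicate (Suc m) True"
    by (auto simp: map_eq_append_conv)
  have "stretch (word T) (replicate m True @ True # X')"
    using X(2) unfolding X' w by (rule stretch_extend)
  then have "stretch (word T) (map snd (rs @ qs))"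
    using qr by (simp add: replicate_app_Cons_same)
  moreover have "set (closed_walk_arcs (rs @ qs)) \<subseteq> A"
    using ps(4) closed set_closed_walk_arcs_rotate[of rs qs] unfolding qr(1) by simp
  ultimately show thesis using ps(1,2) by (intro that[of "rs @ qs"]) (auto simp: qr(1))
qed

section \<open>Subdivisions from stretched words\<close>

lemma pcas_snoc: "pcas u (p @ [e]) v \<longleftrightarrow> pcas u p (fst e) \<and> snd e = v"
  by (induction p arbitrary: u) auto

lemma pawalk_verts_snoc:
  "pcas u p (fst e) \<Longrightarrow> pawalk_verts u (p @ [e]) = pawalk_verts u p @ [snd e]"
  by (induction p arbitrary: u) auto

text \<open>
  If all arcs of a walk have the same direction, they form a directed walk in the sense of the graph
  library, read backwards if the direction is backward. The right-hand sides describe its vertices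
  with and without the last one.
\<close>

lemma monochromatic_walk_path:
  fixes y :: 'v
  assumes "snd ` set ps \<subseteq> {d}" and "ps \<noteq> []"
  defines "x \<equiv> fst (hd ps)" and "p \<equiv> (if d then walk_arcs ps y else rev (walk_arcs ps y))"
  shows "pcas (if d then x else y) p (if d then y else x) \<and>
    pawalk_verts (if d then x else y) p = (if d then map fst ps @ [y] else y # rev (map fst ps)) \<and>
    map fst p = (if d then map fst ps else rev (tl (map fst ps @ [y])))"
  using assms(1,2) unfolding x_def p_def
proof (induction ps)
  case (Cons e ps)
  show ?case
  proof (cases "ps = []")
    case True
    with Cons.prems show ?thesis by auto
  next
    case False
    then have "start ps y = fst (hd ps)" and "rev (map fst ps) = rev (tl (map fst ps)) @ [fst (hd ps)]"
      by (cases ps; simp)+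
    with Cons False show ?thesis by (auto simp: pcas_snoc pawalk_verts_snoc)
  qed
qed simp

lemma walk_arcs_ends: "e \<in> set (walk_arcs ps y) \<Longrightarrow> {fst e, snd e} \<subseteq> insert y (fst ` set ps)"
proof (induction ps)
  case (Cons p ps)
  have mono: "insert y (fst ` set ps) \<subseteq> insert y (fst ` set (p # ps))" by auto
  have "start ps y \<in> insert y (fst ` set ps)" by (cases ps) auto
  with mono have start: "start ps y \<in> insert y (fst ` set (p # ps))" by (rule subsetD)
  show ?case
  proof (cases "e \<in> set (walk_arcs ps y)")
    case True
    then show ?thesis using Cons.IH mono by (meson order_trans)
  next
    case False
    then have "{fst e, snd e} = {fst p, start ps y}"
      using Cons.prems by (auto split: if_splits)
    then show ?thesis using start by (simp only: insert_subset) simp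
  qed
qed simp

lemma length_walk_arcs [simp]: "length (walk_arcs ps y) = length ps"
  by (induction ps) auto

lemma nth_walk_arcs:
  fixes y :: 'v
  assumes "i < length ps"
  defines "z \<equiv> (if Suc i < length ps then fst (ps ! Suc i) else y)"
  shows "walk_arcs ps y ! i = (if snd (ps ! i) then (fst (ps ! i), z) else (z, fst (ps ! i)))"
  using assms(1) unfolding z_def
proof (induction ps arbitrary: i)
  case (Cons p ps)
  then show ?case by (cases i; cases ps) auto
qed simp

lemma set_walk_arcs_concat:
  assumes "\<forall>s\<in>set ss. s \<noteq> []"
  shows "set (walk_arcs (concat ss) y) = (\<Union>i<length ss. set (walk_arcs (ss ! i)
    (if Suc i < length ss then fst (hd (ss ! Suc i)) else y)))"
  using assms
proof (induction ss)
  case (Cons s ss)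
  have "start (concat ss) y = (if ss = [] then y else fst (hd (ss ! 0)))"
    using Cons.prems by (cases ss) (auto simp: start_nonempty)
  with Cons show ?case by (simp add: lessThan_Suc_eq_insert_0 cong: if_cong)
qed simp

lemma distinct_concat_disjoint_nth:
  assumes "distinct (concat xss)" and "i < length xss" and "j < length xss" and "i \<noteq> j"
  shows "set (xss ! i) \<inter> set (xss ! j) = {}"
  using assms
proof (induction xss arbitrary: i j)
  case (Cons xs xss)
  have disj: "set xs \<inter> set (xss ! k) = {}" if "k < length xss" for k
    using Cons.prems(1) nth_mem[OF that] by auto
  show ?case
    using Cons disj by (cases i; cases j) (auto simp: Int_commute)
qed simp

text \<open>
  The segments of the walk that correspond to the single letters of \<open>w\<close>.
\<close>

lemma stretch_segments:
  assumes "stretch w (map snd ps)"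
  obtains ss where "concat ss = ps" "length ss = length w"
    "\<And>i. i < length w \<Longrightarrow> ss ! i \<noteq> [] \<and> snd ` set (ss ! i) \<subseteq> {w ! i}"
proof -
  have "\<exists>ss. concat ss = ps \<and> list_all2 (\<lambda>d s. s \<noteq> [] \<and> snd ` set s \<subseteq> {d}) w ss"
    using assms
  proof (induction w "map snd ps" arbitrary: ps)
    case stretch_Nil
    then show ?case by auto
  next
    case (stretch_Cons w W d m)
    have eq: "map snd ps = replicate (Suc m) d @ W" using stretch_Cons.hyps by simp
    define qs and rs where "qs = take (Suc m) ps" and "rs = drop (Suc m) ps"
    have qr: "ps = qs @ rs" "map snd qs = replicate (Suc m) d" "map snd rs = W"
      by (simp_all add: qs_def rs_def eq flip: take_map drop_map)
    obtain ss where "concat ss = rs"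
      "list_all2 (\<lambda>d s. s \<noteq> [] \<and> snd ` set s \<subseteq> {d}) w ss"
      using stretch_Cons.hyps(2)[of rs] qr(3) by blast
    moreover have "snd ` set qs = {d}" using arg_cong[OF qr(2), of set] by (simp del: replicate_Suc)
    then have "qs \<noteq> [] \<and> snd ` set qs \<subseteq> {d}" by auto
    ultimately show ?case using qr(1) by (intro exI[of _ "qs # ss"]) auto
  qed
  then show thesis using that by (auto simp: list_all2_conv_all_nth)
qed

text \<open>
  The walk \<open>ps\<close> splits into one segment for each arc of \<open>C\<close>. The \<open>i\<close>-th vertex of \<open>C\<close> is sent to the
  first vertex of the \<open>i\<close>-th segment, and the \<open>i\<close>-th arc is replaced by the \<open>i\<close>-th segment.
  Disjointness of all paths is the distinctness of the vertices of \<open>ps\<close>.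
\<close>

lemma contains_subdivision_if_stretch:
  fixes D :: "'a pair_pre_digraph" and C :: "'b pair_pre_digraph"
  assumes "pair_wf_digraph D"
    and ps: "distinct (map fst ps)" "set (closed_walk_arcs ps) \<subseteq> parcs D" "fst ` set ps \<subseteq> pverts D"
    and cs: "distinct (map fst cs)" "3 \<le> length cs"
    and C: "pverts C = fst ` set cs" "parcs C = set (closed_walk_arcs cs)"
    and "stretch (map snd cs) (map snd ps)"
  shows "contains_subdivision D C"
proof -
  define n where "n = length cs"
  have n: "3 \<le> n" using cs(2) n_def by simp
  obtain ss where ss: "concat ss = ps" "length ss = n"
    "\<And>i. i < n \<Longrightarrow> ss ! i \<noteq> []" "\<And>i. i < n \<Longrightarrow> snd ` set (ss ! i) \<subseteq> {snd (cs ! i)}"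
    by (rule stretch_segments[OF assms(9)]) (simp add: n_def)
  \<comment> \<open>Cyclic indexing: \<open>b i\<close> is the branch vertex in \<open>D\<close> for the vertex \<open>c i\<close> of \<open>C\<close>, and \<open>Q i\<close> is
    the directed path in \<open>D\<close> for the arc \<open>e i\<close> of \<open>C\<close>.\<close>
  define succ where "succ i = (if Suc i < n then Suc i else 0)" for i
  have succ: "succ i < n" "succ i \<noteq> i" "succ (succ i) \<noteq> i" if "i < n" for i
    using n that by (auto simp: succ_def)
  define b where "b i = fst (hd (ss ! i))" for i
  define c where "c i = fst (cs ! i)" for i
  define dir where "dir i = snd (cs ! i)" for i
  define e where "e i = (if dir i then (c i, c (succ i)) else (c (succ i), c i))" for i
  define Q where "Q i = (if dir i then walk_arcs (ss ! i) (b (succ i))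
    else rev (walk_arcs (ss ! i) (b (succ i))))" for i
  have ss0: "ss = ss ! 0 # tl ss" "cs = cs ! 0 # tl cs"
    using n ss(2) n_def by (cases ss; cases cs; simp)+
  have "fst (hd ps) = b 0"
    using ss(1) ss(3)[of 0] n ss0(1) by (metis b_def concat.simps(2) hd_append2 less_le_trans zero_less_numeral)
  have "fst (hd cs) = c 0" unfolding c_def using ss0(2) by (metis list.sel(1))

  have inj_c: "inj_on c {..<n}"
    using cs(1) by (auto simp: inj_on_def c_def n_def distinct_conv_nth)
  have verts_C: "pverts C = c ` {..<n}"
    unfolding C(1) by (auto simp: c_def n_def set_conv_nth)
  have "closed_walk_arcs cs = map e [0..<n]"
    by (rule nth_equalityI)
      (auto simp: nth_walk_arcs e_def c_def dir_def succ_def n_def \<open>fst (hd cs) = c 0\<close>)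
  then have arcs_C: "parcs C = e ` {..<n}" unfolding C(2) by (auto simp: atLeast0LessThan)
  \<comment> \<open>Two different positions give the same arc only on a cycle with two vertices.\<close>
  have inj_e: "inj_on e {..<n}"
  proof (rule inj_onI)
    fix i j assume ij: "i \<in> {..<n}" "j \<in> {..<n}" "e i = e j"
    then have "c i = c j \<or> c i = c (succ j) \<and> c (succ i) = c j"
      by (auto simp: e_def split: if_splits)
    then have "i = j \<or> i = succ j \<and> succ i = j"
      using inj_onD[OF inj_c] ij succ by blast
    then show "i = j" using succ ij by auto
  qed

  have arcs_ps: "set (closed_walk_arcs ps) = (\<Union>i<n. set (Q i))"
  proof -
    have "\<forall>s\<in>set ss. s \<noteq> []" using ss(2,3) by (auto simp: in_set_conv_nth)
    then have "set (closed_walk_arcs ps) = (\<Union>i<n. set (walk_arcs (ss ! i)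
        (if Suc i < n then fst (hd (ss ! Suc i)) else b 0)))"
      using set_walk_arcs_concat[of ss "b 0"] ss(1,2) \<open>fst (hd ps) = b 0\<close> by simp
    also have "\<dots> = (\<Union>i<n. set (Q i))"
      by (intro SUP_cong) (auto simp: Q_def succ_def b_def)
    finally show ?thesis .
  qed
  have disj: "fst ` set (ss ! i) \<inter> fst ` set (ss ! j) = {}" if "i < n" "j < n" "i \<noteq> j" for i j
    using distinct_concat_disjoint_nth[of "map (map fst) ss" i j] that ps(1) ss(1,2)
    by (auto simp flip: map_concat)
  have distinct_seg: "distinct (map fst (ss ! i))" if "i < n" for i
    using ps(1) that ss(2) nth_mem[of i ss]
    by (auto simp: distinct_concat_iff map_concat simp flip: ss(1))
  have b_in: "b i \<in> fst ` set (ss ! i)" if "i < n" for i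
    using ss(3)[OF that] by (auto simp: b_def)
  have b_eq: "b i \<in> fst ` set (ss ! j) \<longleftrightarrow> i = j" if "i < n" "j < n" for i j
    using disj[OF that] b_in that by blast
  have seg: "map fst (ss ! i) = b i # tl (map fst (ss ! i))" if "i < n" for i
    using ss(3)[OF that] by (cases "ss ! i") (auto simp: b_def)

  define inner where "inner i = set (tl (map fst (ss ! i)))" for i
  have inner_sub: "fst ` set (ss ! i) = insert (b i) (inner i)" "b i \<notin> inner i" if "i < n" for i
  proof -
    show "fst ` set (ss ! i) = insert (b i) (inner i)"
      using arg_cong[OF seg[OF that], of set] by (simp add: inner_def)
    have "distinct (b i # tl (map fst (ss ! i)))"
      using distinct_seg[OF that] by (simp only: seg[OF that, symmetric])
    then show "b i \<notin> inner i" by (simp add: inner_def)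
  qed
  have path: "pcas (if dir i then b i else b (succ i)) (Q i) (if dir i then b (succ i) else b i)"
      "distinct (pawalk_verts (if dir i then b i else b (succ i)) (Q i))"
      "set (tl (map fst (Q i))) = inner i" "Q i \<noteq> []" if "i < n" for i
  proof -
    have *: "pcas (if dir i then b i else b (succ i)) (Q i) (if dir i then b (succ i) else b i) \<and>
      pawalk_verts (if dir i then b i else b (succ i)) (Q i) =
        (if dir i then map fst (ss ! i) @ [b (succ i)] else b (succ i) # rev (map fst (ss ! i))) \<and>
      map fst (Q i) = (if dir i then map fst (ss ! i) else rev (tl (map fst (ss ! i) @ [b (succ i)])))"
      using monochromatic_walk_path[of "ss ! i" "dir i" "b (succ i)"] ss(3,4)[OF that]
      unfolding Q_def b_def dir_def by blast
    then show "pcas (if dir i then b i else b (succ i)) (Q i) (if dir i then b (succ i) else b i)"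
      by blast
    have "b (succ i) \<notin> set (map fst (ss ! i))" using b_eq[of "succ i" i] succ that by auto
    with * distinct_seg[OF that]
    show "distinct (pawalk_verts (if dir i then b i else b (succ i)) (Q i))"
      by (simp split: if_splits)
    have "tl (map fst (ss ! i) @ [b (succ i)]) = tl (map fst (ss ! i)) @ [b (succ i)]"
      using ss(3)[OF that] by simp
    with * show "set (tl (map fst (Q i))) = inner i"
      by (auto simp: inner_def split: if_splits)
    have "length (Q i) = length (ss ! i)" by (simp add: Q_def)
    then show "Q i \<noteq> []" using ss(3)[OF that] by auto
  qed

  define f where "f x = b (inv_into {..<n} c x)" for x
  define P where "P a = Q (inv_into {..<n} e a)" for a
  have f: "f (c i) = b i" if "i < n" for i using that inj_c by (simp add: f_def)
  have P: "P (e i) = Q i" if "i < n" for i using that inj_e by (simp add: P_def)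
  have f_verts: "f ` pverts C = b ` {..<n}"
    unfolding verts_C image_image by (intro image_cong) (auto simp: f)
  define H where "H = \<lparr>pverts = fst ` set ps, parcs = set (closed_walk_arcs ps)\<rparr>"
  have verts_H: "pverts H = (\<Union>i<n. fst ` set (ss ! i))"
  proof -
    have "set ss = (!) ss ` {..<n}" using ss(2) by (auto simp: set_conv_nth)
    then show ?thesis by (simp add: H_def image_UN flip: ss(1))
  qed

  have "inj_on f (pverts C)"
  proof -
    have "inj_on b {..<n}" using b_eq b_in by (metis inj_onI lessThan_iff)
    then have "inj_on (f \<circ> c) {..<n}" by (rule inj_on_cong[THEN iffD1, rotated]) (simp add: f)
    then show ?thesis unfolding verts_C by (rule inj_on_imageI)
  qed
  moreover have "pre_digraph.gen_iapath (with_proj H) (f ` pverts C) (f x) (P (x, y)) (f y)"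
    if "(x, y) \<in> parcs C" for x y
  proof -
    from that obtain i where i: "i < n" "e i = (x, y)" unfolding arcs_C by auto
    have xy: "f x = (if dir i then b i else b (succ i))" "f y = (if dir i then b (succ i) else b i)"
      using i succ f by (auto simp: e_def split: if_splits)
    have "f x \<in> b ` {..<n}" "f y \<in> b ` {..<n}" using xy i(1) succ(1) by auto
    moreover have "b ` {..<n} \<subseteq> pverts H" unfolding verts_H using b_in by blast
    moreover have "set (Q i) \<subseteq> parcs H" using i(1) arcs_ps by (auto simp: H_def)
    moreover have "inner i \<inter> b ` {..<n} = {}"
      using inner_sub[OF i(1)] b_eq i(1) by auto
    ultimately show ?thesis
      using path[OF i(1)] P[OF i(1)] i(2) f_verts
      by (auto simp: pre_digraph.gen_iapath_def pre_digraph.apath_def pre_digraph.awalk_def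
          inner_verts_with_proj_def cas_with_proj_eq awalk_verts_with_proj_eq simp flip: xy)
  qed
  moreover have inner: "set (pre_digraph.inner_verts (with_proj H) (P (e i))) = inner i"
    if "i < n" for i
    using path(3)[OF that] P[OF that] by (simp add: inner_verts_with_proj_def)
  have "inner i \<inter> inner j = {}" if "i < n" "j < n" "i \<noteq> j" for i j
    using disj[OF that] inner_sub that by auto
  then have "set (pre_digraph.inner_verts (with_proj H) (P a)) \<inter>
      set (pre_digraph.inner_verts (with_proj H) (P a')) = {}"
    if "a \<in> parcs C" "a' \<in> parcs C" "a \<noteq> a'" for a a'
    using that inner unfolding arcs_C by blast
  moreover have "pverts H = f ` pverts C \<union>
      (\<Union>a\<in>parcs C. set (pre_digraph.inner_verts (with_proj H) (P a)))"
    unfolding verts_H f_verts arcs_C using inner inner_sub(1) by auto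
  moreover have "parcs H = (\<Union>a\<in>parcs C. set (P a))"
    using P arcs_ps unfolding arcs_C by (auto simp: H_def)
  ultimately have "digraph_subdivision C H"
    unfolding digraph_subdivision_def by (intro exI[of _ f] exI[of _ P]) auto
  moreover have "subgraph (with_proj H) (with_proj D)"
  proof -
    have "ps \<noteq> []" using ss(1,2) ss(3)[of 0] n by (cases ss) auto
    then have "fst (hd ps) \<in> fst ` set ps" by simp
    then have "{fst a, snd a} \<subseteq> fst ` set ps" if "a \<in> set (closed_walk_arcs ps)" for a
      using walk_arcs_ends[OF that] by (simp only: insert_absorb)
    then have "pair_wf_digraph H" by unfold_locales (simp_all add: H_def)
    then show ?thesis
      using assms(1) ps(2,3)
      by (auto simp: subgraph_def compatible_def wf_digraph_wp_iff H_def)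
  qed
  ultimately show ?thesis unfolding contains_subdivision_def by (intro exI[of _ H] conjI)
qed

section \<open>Cycles as closed walks\<close>

lemma pawalk_verts_conv: "pcas u p v \<Longrightarrow> pawalk_verts u p = map fst p @ [v]"
  by (induction p arbitrary: u) auto

lemma walk_arcs_if_pcas:
  assumes "pcas u p v"
  shows "walk_arcs (map (\<lambda>e. (fst e, t e)) p) v = map (\<lambda>e. if t e then e else prod.swap e) p \<and>
    start (map (\<lambda>e. (fst e, t e)) p) v = u"
  using assms by (induction p arbitrary: u) auto

text \<open>
  Given an arbitrary choice \<open>t\<close> of directions, the arcs of a cycle of \<open>G\<close> are kept or reversed. This
  covers both a directed circuit (\<open>t\<close> constantly true) and an oriented cycle, whose underlying
  circuit is traversed against some of the arcs.
\<close>

lemma cycle_closed_walk: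
  assumes "pre_digraph.cycle (with_proj G) p"
  shows "p \<noteq> []" and "distinct (map fst p)" and "set p \<subseteq> parcs G"
    and "closed_walk_arcs (map (\<lambda>e. (fst e, t e)) p) =
      map (\<lambda>e. if t e then e else prod.swap e) p"
proof -
  obtain u where p: "p \<noteq> []" "set p \<subseteq> parcs G" "pcas u p u" "distinct (tl (pawalk_verts u p))"
    using assms by (auto simp: pre_digraph.cycle_def pre_digraph.awalk_def cas_with_proj_eq
        awalk_verts_with_proj_eq)
  then show "p \<noteq> []" "set p \<subseteq> parcs G" by simp_all
  have "fst (hd p) = u" using p(1,3) by (cases p) auto
  then show "distinct (map fst p)"
    using p(1,4) unfolding pawalk_verts_conv[OF p(3)] by (cases p) auto
  show "closed_walk_arcs (map (\<lambda>e. (fst e, t e)) p) =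
      map (\<lambda>e. if t e then e else prod.swap e) p"
    using walk_arcs_if_pcas[OF p(3), of t] p(1) \<open>fst (hd p) = u\<close> by (simp add: hd_map)
qed

lemma hamiltonian_closed_walk:
  assumes "hamiltonian D"
  obtains xs where "distinct xs" "set xs = pverts D"
    "set (closed_walk_arcs (forward xs)) \<subseteq> parcs D"
proof -
  obtain p where p: "pre_digraph.cycle (with_proj D) p" "fst ` set p = pverts D"
    using assms by (auto simp: hamiltonian_def)
  note walk = cycle_closed_walk(1-3)[OF p(1)] cycle_closed_walk(4)[OF p(1), of "\<lambda>_. True"]
  show thesis
    using walk p(2) by (intro that[of "map fst p"]) (simp_all add: comp_def)
qed

lemma in_parcs_underlying_graph:
  "(u, v) \<in> parcs (underlying_graph D) \<longleftrightarrow> (u, v) \<in> parcs D \<or> (v, u) \<in> parcs D"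
  by (auto simp: parcs_mk_symmetric Bex_def)

lemma oriented_cycle_closed_walk:
  assumes "oriented_cycle C"
  obtains cs where "distinct (map fst cs)" "3 \<le> length cs" "pverts C = fst ` set cs"
    "parcs C = set (closed_walk_arcs cs)"
proof -
  interpret oriented_digraph C using assms by (simp add: oriented_cycle_def)
  obtain p where p: "pre_digraph.cycle (with_proj (underlying_graph C)) p" "3 \<le> length p"
    "pverts C = fst ` set p" "parcs (underlying_graph C) = set p \<union> (set p)\<inverse>"
    using assms by (auto simp: oriented_cycle_def cycle_graph_def)
  define t where "t e = (e \<in> parcs C)" for e
  note walk = cycle_closed_walk(1-3)[OF p(1)] cycle_closed_walk(4)[OF p(1), of t]
  have under: "e \<in> parcs C \<or> prod.swap e \<in> parcs C \<longleftrightarrow> e \<in> set p \<or> prod.swap e \<in> set p" for e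
    using p(4) in_parcs_underlying_graph[of "fst e" "snd e" C] by (cases e) auto
  have "parcs C = (\<lambda>e. if t e then e else prod.swap e) ` set p"
  proof (intro equalityI subsetI)
    fix e assume e: "e \<in> parcs C"
    then have "prod.swap e \<notin> parcs C" using no_opposite_arcs by (cases e) auto
    moreover have "e \<in> set p \<or> prod.swap e \<in> set p" using under e by blast
    ultimately show "e \<in> (\<lambda>e. if t e then e else prod.swap e) ` set p"
      using e by (force simp: t_def image_iff)
  next
    fix e assume "e \<in> (\<lambda>e. if t e then e else prod.swap e) ` set p"
    then show "e \<in> parcs C" using under by (auto simp: t_def split: if_splits)
  qed
  then show thesis
    using walk p(2,3) by (intro that[of "map (\<lambda>e. (fst e, t e)) p"]) (auto simp: comp_def image_image)
qed

lemma count_list_map_Not: "count_list (map Not w) b = count_list w (\<not> b)"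
  by (induction w) auto

lemma closed_walk_reverse:
  assumes "cs \<noteq> []"
  defines "rs \<equiv> reverse_walk cs (fst (hd cs))"
  shows "mset (map fst rs) = mset (map fst cs)"
    and "set (closed_walk_arcs rs) = set (closed_walk_arcs cs)"
    and "map snd rs = rev (map Not (map snd cs))"
proof -
  show "mset (map fst rs) = mset (map fst cs)"
    using assms(1) unfolding rs_def map_fst_reverse_walk by (cases cs) simp_all
  have "rs \<noteq> []" using assms by (cases cs) auto
  then have "fst (hd rs) = start cs (fst (hd cs))"
    using start_reverse_walk[of cs "fst (hd cs)"] assms(1) unfolding rs_def
    by (metis start_nonempty)
  then show "set (closed_walk_arcs rs) = set (closed_walk_arcs cs)"
    unfolding rs_def by (simp add: walk_arcs_reverse_walk)
  show "map snd rs = rev (map Not (map snd cs))"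
    by (simp add: rs_def map_snd_reverse_walk comp_def)
qed

text \<open>
  Traversing \<open>C\<close> in the other direction exchanges forward and backward arcs, so at most half of them
  are backward without loss of generality; then some arc is forward, and the traversal can start
  with it. As each backward arc costs three and each forward arc one, the cost is at most twice the
  number of arcs.
\<close>

lemma oriented_cycle_word:
  assumes "oriented_cycle C"
  obtains cs T where "distinct (map fst cs)" "3 \<le> length cs" "pverts C = fst ` set cs"
    "parcs C = set (closed_walk_arcs cs)" "map snd cs = word T" "T \<noteq> []"
    "cost T \<le> 2 * card (pverts C)"
proof -
  obtain as where as: "distinct (map fst as)" "3 \<le> length as" "pverts C = fst ` set as"
    "parcs C = set (closed_walk_arcs as)"
    using oriented_cycle_closed_walk[OF assms] .
  obtain bs where bs: "mset (map fst bs) = mset (map fst as)"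
    "set (closed_walk_arcs bs) = set (closed_walk_arcs as)"
    "count_list (map snd bs) False \<le> count_list (map snd bs) True"
  proof (cases "count_list (map snd as) False \<le> count_list (map snd as) True")
    case True
    then show thesis using that[of as] by simp
  next
    case False
    have "as \<noteq> []" using as(2) by auto
    note rev = closed_walk_reverse[OF this]
    show thesis
      using False by (intro that[OF rev(1,2)]) (simp add: rev(3) count_list_map_Not del: map_map)
  qed
  have len: "length bs = length as" using mset_eq_length[OF bs(1)] by simp
  have count: "count_list w True + count_list w False = length w" for w
    by (induction w) auto
  have "0 < count_list (map snd bs) True"
    using count[of "map snd bs"] bs(3) as(2) len by simp
  then have "True \<in> set (map snd bs)" using count_notin by fastforce
  then obtain v where "(v, True) \<in> set bs" by auto
  then obtain us ws where split: "bs = us @ (v, True) # ws" by (meson split_list)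
  define cs where "cs = ((v, True) # ws) @ us"
  have arcs: "set (closed_walk_arcs cs) = set (closed_walk_arcs bs)"
    unfolding cs_def split by (rule set_closed_walk_arcs_rotate)
  have mset: "mset (map fst cs) = mset (map fst as)"
    unfolding bs(1)[symmetric] by (simp add: cs_def split)
  have "map snd cs = True # map snd (ws @ us)" by (simp add: cs_def)
  then obtain T where T: "map snd cs = word T" using word_surj by metis
  then have "T \<noteq> []" by (auto simp: cs_def)
  have "length cs = length as" using mset_eq_length[OF mset] by simp
  have dist: "distinct (map fst cs)" using as(1) mset mset_eq_imp_distinct_iff by blast
  have "count_list (word T) b = count_list (map snd bs) b" for b
    unfolding T[symmetric] by (simp add: cs_def split)
  then have "cost T \<le> 2 * length as"
    using cost_eq[of T] count[of "map snd bs"] bs(3) len by simp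
  also have "length as = card (pverts C)"
    using distinct_card[OF as(1)] as(3) by simp
  finally have "cost T \<le> 2 * card (pverts C)" .
  moreover have "pverts C = fst ` set cs"
    using as(3) mset_eq_setD[OF mset] by simp
  ultimately show thesis
    using that[OF dist _ _ _ T \<open>T \<noteq> []\<close>] \<open>length cs = length as\<close> as(2,4) arcs bs(2) by simp
qed

section \<open>Subdivisions of oriented cycles in Hamiltonian digraphs\<close>

lemma not_colourable_if_less_chromatic_number:
  assumes "pair_digraph D" and "k < chromatic_number D"
  shows "\<not> colourable (parcs D) (pverts D) k"
proof
  interpret pair_digraph D by fact
  assume "colourable (parcs D) (pverts D) k"
  then obtain c where c: "\<forall>v\<in>pverts D. c v < k"
    "\<forall>u\<in>pverts D. \<forall>v\<in>pverts D. u \<noteq> v \<and> (u, v) \<in> parcs D \<longrightarrow> c u \<noteq> c v"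
    unfolding colourable_def by blast
  have "c u \<noteq> c v" if "(u, v) \<in> parcs D" for u v
    using c(2) that wellformed' pair_no_loops[OF that] by auto
  then have "\<forall>(u, v)\<in>parcs (underlying_graph D). c u \<noteq> c v"
    by (auto simp: in_parcs_underlying_graph) (metis)
  then have "proper_coloring (underlying_graph D) k c"
    using c(1) by (auto simp: proper_coloring_def)
  then have "chromatic_number D \<le> k"
    unfolding chromatic_number_def graph_chromatic_number_def by (intro Least_le) blast
  with assms(2) show False by simp
qed

theorem theorem3p1:
  fixes n :: nat
    and D :: "'a pair_pre_digraph"
    and C :: "'b pair_pre_digraph"
  assumes "0 < n"
    and "oriented_digraph D"
    and "hamiltonian D"
    and "chromatic_number D = 2 * n"
    and "oriented_cycle C"
    and "card (pverts C) = n"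
  shows "contains_subdivision D C"
proof -
  interpret oriented_digraph D by fact
  obtain xs where xs: "distinct xs" "set xs = pverts D"
    "set (closed_walk_arcs (forward xs)) \<subseteq> parcs D"
    using hamiltonian_closed_walk[OF assms(3)] .
  obtain cs T where cs: "distinct (map fst cs)" "3 \<le> length cs" "pverts C = fst ` set cs"
    "parcs C = set (closed_walk_arcs cs)" "map snd cs = word T" "T \<noteq> []"
    "cost T \<le> 2 * card (pverts C)"
    using oriented_cycle_word[OF assms(5)] .
  have "\<not> colourable (parcs D) (set xs) k" if "k < cost T" for k
    unfolding xs(2)
    using that cs(7) assms(4,6) pair_digraph_axioms
    by (intro not_colourable_if_less_chromatic_number) auto
  then obtain ps where ps: "distinct (map fst ps)" "fst ` set ps \<subseteq> set xs"
    "set (closed_walk_arcs ps) \<subseteq> parcs D" "stretch (word T) (map snd ps)"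
    using closed_traversal[OF xs(1,3) cs(6)] by blast
  show ?thesis
    using ps(2,4) cs(5) xs(2) pair_wf_digraph_axioms
    by (intro contains_subdivision_if_stretch[OF _ ps(1,3) _ cs(1-4)]) simp_all
qed

end
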